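(* Let $f\colon\mathbb{R}^{N\times n}\to\mathbb{R}$ be rank-one convex and positively $1$-homogeneous. Then $f$ is convex at each point of the rank one cone $\{x\in\mathbb{R}^{N\times n}:\operatorname{rank}x\leq 1\}$; that is, for each $x_0\in\mathbb{R}^{N\times n}$ with $\operatorname{rank}x_0\leq 1$ there exists a linear function $\ell\colon\mathbb{R}^{N\times n}\to\mathbb{R}$ with $\ell(x_0)=f(x_0)$ and $f(x)\geq\ell(x)$ for all $x\in\mathbb{R}^{N\times n}$.
   Context: $\mathbb{R}^{N\times n}$ is the space of real $N\times n$ matrices. A function $f\colon\mathbb{R}^{N\times n}\to\mathbb{R}$ is rank-one convex if its restriction to every segment $[x,y]$ with $\operatorname{rank}(x-y)\leq 1$ is convex. It is positively $1$-homogeneous if $f(tx)=tf(x)$ for all $t>0$ and all $x$. *)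

theory Defs
  imports "HOL-Analysis.Analysis"
begin

definition rank_one_convex :: "(real ^ 'n ^ 'm \<Rightarrow> real) \<Rightarrow> bool" where
  "rank_one_convex f \<longleftrightarrow>
     (\<forall>x y. rank (x - y) \<le> 1 \<longrightarrow> convex_on (closed_segment x y) f)"

definition positively_1_homogeneous :: "('a::real_vector \<Rightarrow> real) \<Rightarrow> bool" where
  "positively_1_homogeneous f \<longleftrightarrow> (\<forall>t>0. \<forall>x. f (t *\<^sub>R x) = t * f x)"

end

theory Submission
  imports Defs
begin

text \<open>
  The proof minorizes \<open>f\<close> by functions that are affine along more and more lines.

  Let \<open>f\<close> be positively homogeneous and convex along all lines with direction in some spanning
  set, and let \<open>v\<close> be such a direction.  The difference quotients of the convex function
  \<open>t \<mapsto> f (x + t v)\<close> increase to the limit of \<open>f (x + t v) / t = f (x / t + v)\<close>, which is at most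
  \<open>f v\<close>, because separate convexity already makes \<open>f\<close> upper semicontinuous along rays.  Hence
  \<open>f (x + v) \<le> f x + f v\<close> (\<open>subadditive_along_convex_direction\<close>).  This makes
  \<open>t \<mapsto> f (x + t v) - t f v\<close> decreasing, and moving off \<open>x\<close> in finitely many steps along convex
  directions bounds it from below.  Its limit \<open>g x\<close>, which is the one-sided
  derivative of \<open>f\<close> at \<open>v\<close> in direction \<open>x\<close>, lies below \<open>f x\<close>.  The function \<open>g\<close> is again
  homogeneous and convex along the same lines, it keeps all directions along which \<open>f\<close> was affine,
  and it satisfies \<open>g (x + t v) = g x + t f v\<close> (\<open>affine_minorant_along_convex_direction\<close>).

  Starting with \<open>v = x0\<close> and continuing with a finite spanning set of convex directions yields
  a minorant of \<open>f\<close> that is affine along a spanning set, hence linear, and that still has the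
  value \<open>f x0\<close> at \<open>x0\<close>.  For matrices, the matrix units provide the spanning set.
\<close>

section \<open>Directions of convexity and of affinity\<close>

definition convex_directions :: "('a::real_vector \<Rightarrow> real) \<Rightarrow> 'a set" where
  "convex_directions f = {v. \<forall>x. convex_on UNIV (\<lambda>t. f (x + t *\<^sub>R v))}"

text \<open>
  The slope is required to be \<open>f v\<close>, so that for \<open>f 0 = 0\<close> these are exactly the directions along
  which \<open>f\<close> is affine with the same slope on all parallel lines.
\<close>
definition affine_directions :: "('a::real_vector \<Rightarrow> real) \<Rightarrow> 'a set" where
  "affine_directions f = {v. \<forall>x t. f (x + t *\<^sub>R v) = f x + t * f v}"

lemma convex_directionsI:
  assumes "\<And>x s a b. 0 < s \<Longrightarrow> s < 1 \<Longrightarrow>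
    f (x + ((1 - s) * a + s * b) *\<^sub>R v) \<le> (1 - s) * f (x + a *\<^sub>R v) + s * f (x + b *\<^sub>R v)"
  shows "v \<in> convex_directions f"
  unfolding convex_directions_def using assms by (auto intro!: convex_onI)

lemma convex_directionsD:
  assumes "v \<in> convex_directions f" "0 \<le> s" "s \<le> 1"
  shows "f (x + ((1 - s) * a + s * b) *\<^sub>R v) \<le> (1 - s) * f (x + a *\<^sub>R v) + s * f (x + b *\<^sub>R v)"
proof -
  have "convex_on UNIV (\<lambda>t. f (x + t *\<^sub>R v))"
    using assms(1) by (simp add: convex_directions_def)
  from convex_onD[OF this assms(2,3), of a b] show ?thesis by simp
qed

lemma convex_directions_ineq:
  assumes "v \<in> convex_directions f" "0 \<le> s" "s \<le> 1"
  shows "f (x + s *\<^sub>R v) \<le> (1 - s) * f x + s * f (x + v)"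
  using convex_directionsD[OF assms, of x 0 1] by simp

lemma convex_directions_scaleR:
  assumes "v \<in> convex_directions f"
  shows "c *\<^sub>R v \<in> convex_directions f"
proof (rule convex_directionsI)
  fix x and s a b :: real
  assume "0 < s" "s < 1"
  then show "f (x + ((1 - s) * a + s * b) *\<^sub>R c *\<^sub>R v)
      \<le> (1 - s) * f (x + a *\<^sub>R c *\<^sub>R v) + s * f (x + b *\<^sub>R c *\<^sub>R v)"
    using convex_directionsD[OF assms, of s x "a * c" "b * c"] by (simp add: algebra_simps)
qed

lemma affine_directionsD:
  "v \<in> affine_directions f \<Longrightarrow> f (x + t *\<^sub>R v) = f x + t * f v"
  by (simp add: affine_directions_def)

lemma positively_1_homogeneousD:
  "positively_1_homogeneous f \<Longrightarrow> t > 0 \<Longrightarrow> f (t *\<^sub>R x) = t * f x"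
  by (simp add: positively_1_homogeneous_def)

lemma positively_1_homogeneous_zero:
  assumes "positively_1_homogeneous f"
  shows "f 0 = 0"
  using positively_1_homogeneousD[OF assms, of 2 0] by simp

section \<open>Subadditivity and one-sided bounds\<close>

text \<open>
  Moving from \<open>p\<close> by \<open>s x\<close> is done in steps \<open>s v\<close> along convex directions \<open>v\<close>.  A single step
  replaces the value by a convex combination with weights \<open>1 - s\<close> and \<open>s\<close>, so it costs \<open>O(s)\<close>;
  the induction hypothesis is needed at both end points of the step.
\<close>
lemma upper_bound_along_ray:
  assumes "x \<in> span (convex_directions f)"
  shows "\<exists>C. \<forall>s. 0 \<le> s \<and> s \<le> 1 \<longrightarrow> f (p + s *\<^sub>R x) \<le> f p + C * s"
  using assms
proof (induction arbitrary: p rule: span_induct_alt)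
  case base
  show ?case by (auto intro: exI[of _ 0])
next
  case (step c v y)
  define w where "w = c *\<^sub>R v"
  have w: "w \<in> convex_directions f"
    unfolding w_def using step.hyps by (rule convex_directions_scaleR)
  obtain C where C: "\<And>s. 0 \<le> s \<Longrightarrow> s \<le> 1 \<Longrightarrow> f (p + s *\<^sub>R y) \<le> f p + C * s"
    using step.IH[of p] by blast
  obtain C' where C': "\<And>s. 0 \<le> s \<Longrightarrow> s \<le> 1 \<Longrightarrow> f (p + w + s *\<^sub>R y) \<le> f (p + w) + C' * s"
    using step.IH[of "p + w"] by blast
  have "f (p + s *\<^sub>R (w + y)) \<le> f p + (\<bar>C\<bar> + \<bar>C'\<bar> + f (p + w) - f p) * s"
    if s: "0 \<le> s" "s \<le> 1" for s
  proof -
    have "f (p + s *\<^sub>R (w + y)) = f ((p + s *\<^sub>R y) + s *\<^sub>R w)"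
      by (simp add: algebra_simps)
    also have "\<dots> \<le> (1 - s) * f (p + s *\<^sub>R y) + s * f (p + w + s *\<^sub>R y)"
      using convex_directions_ineq[OF w s, of "p + s *\<^sub>R y"] by (simp add: algebra_simps)
    also have "\<dots> \<le> (1 - s) * (f p + \<bar>C\<bar> * s) + s * (f (p + w) + \<bar>C'\<bar>)"
    proof (intro add_mono mult_left_mono)
      have "C * s \<le> \<bar>C\<bar> * s" using s by (intro mult_right_mono) auto
      then show "f (p + s *\<^sub>R y) \<le> f p + \<bar>C\<bar> * s" using C[OF s] by linarith
      have "C' * s \<le> \<bar>C'\<bar> * 1" using s by (intro mult_mono) auto
      then show "f (p + w + s *\<^sub>R y) \<le> f (p + w) + \<bar>C'\<bar>" using C'[OF s] by linarith
    qed (use s in auto)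
    also have "\<dots> = f p + (\<bar>C\<bar> + \<bar>C'\<bar> + f (p + w) - f p) * s - \<bar>C\<bar> * s * s"
      by (simp add: algebra_simps)
    also have "\<dots> \<le> f p + (\<bar>C\<bar> + \<bar>C'\<bar> + f (p + w) - f p) * s"
      using s by simp
    finally show ?thesis .
  qed
  then show ?case unfolding w_def by blast
qed

text \<open>
  By convexity, \<open>f (x + v) \<le> (1 - s) f x + s f (x + v / s)\<close> for small \<open>s\<close>, and homogeneity turns the
  last term into \<open>f (v + s x)\<close>, whose upper limit for \<open>s \<rightarrow> 0\<close> is at most \<open>f v\<close>.
\<close>
lemma subadditive_along_convex_direction:
  assumes hom: "positively_1_homogeneous f"
    and v: "v \<in> convex_directions f"
    and x: "x \<in> span (convex_directions f)"
  shows "f (x + v) \<le> f x + f v"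
proof -
  obtain C where C: "\<And>s. 0 \<le> s \<Longrightarrow> s \<le> 1 \<Longrightarrow> f (v + s *\<^sub>R x) \<le> f v + C * s"
    using upper_bound_along_ray[OF x, of v] by blast
  have bound: "f (x + v) \<le> (1 - s) * f x + (f v + C * s)" if s: "0 < s" "s < 1" for s
  proof -
    have "f (x + v) = f (x + s *\<^sub>R ((1/s) *\<^sub>R v))" using s by simp
    also have "\<dots> \<le> (1 - s) * f x + s * f (x + (1/s) *\<^sub>R v)"
      using s by (intro convex_directions_ineq convex_directions_scaleR[OF v]) auto
    also have "s * f (x + (1/s) *\<^sub>R v) = f (s *\<^sub>R (x + (1/s) *\<^sub>R v))"
      using positively_1_homogeneousD[OF hom s(1)] by simp
    also have "s *\<^sub>R (x + (1/s) *\<^sub>R v) = v + s *\<^sub>R x"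
      using s by (simp add: algebra_simps)
    also have "f (v + s *\<^sub>R x) \<le> f v + C * s" using C s by simp
    finally show ?thesis by simp
  qed
  have lim: "((\<lambda>s. (1 - s) * f x + (f v + C * s)) \<longlongrightarrow> (1 - 0) * f x + (f v + C * 0)) (at_right 0)"
    by (intro tendsto_intros)
  have "eventually (\<lambda>s::real. 0 < s \<and> s < 1) (at_right 0)"
    using eventually_at_right_real[of 0 "1::real"] by simp
  then have "eventually (\<lambda>s. f (x + v) \<le> (1 - s) * f x + (f v + C * s)) (at_right 0)"
    by eventually_elim (use bound in blast)
  from tendsto_lowerbound[OF lim this] show ?thesis by simp
qed

text \<open>
  Subadditivity along \<open>- v\<close> bounds \<open>f p\<close> above by \<open>f (p + v) + f (- v)\<close>.  The constant does not
  depend on \<open>p\<close>, so finitely many such steps give a bound that is uniform in \<open>p\<close>.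
\<close>
lemma uniform_lower_bound_of_translate:
  assumes hom: "positively_1_homogeneous f"
    and span: "span (convex_directions f) = UNIV"
  shows "\<exists>C. \<forall>p. f p \<le> f (p + x) + C"
proof -
  have "x \<in> span (convex_directions f)" using span by simp
  then show ?thesis
  proof (induction rule: span_induct_alt)
    case base
    show ?case by (auto intro: exI[of _ 0])
  next
    case (step c v y)
    then obtain C where C: "\<And>p. f p \<le> f (p + y) + C" by blast
    have "f p \<le> f (p + (c *\<^sub>R v + y)) + (C + f ((- c) *\<^sub>R v))" for p
    proof -
      have "f p = f ((p + c *\<^sub>R v) + (- c) *\<^sub>R v)" by simp
      also have "\<dots> \<le> f (p + c *\<^sub>R v) + f ((- c) *\<^sub>R v)"
        by (rule subadditive_along_convex_direction[OF hom convex_directions_scaleR])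
          (use step.hyps span in auto)
      also have "f (p + c *\<^sub>R v) \<le> f (p + (c *\<^sub>R v + y)) + C"
        using C[of "p + c *\<^sub>R v"] by (simp add: add.assoc)
      finally show ?thesis by simp
    qed
    then show ?case by blast
  qed
qed

section \<open>Minorants with more directions of affinity\<close>

lemma recession_limit_exists:
  assumes hom: "positively_1_homogeneous f"
    and span: "span (convex_directions f) = UNIV"
    and v: "v \<in> convex_directions f"
  shows "\<exists>L. ((\<lambda>t. f (x + t *\<^sub>R v) - t * f v) \<longlongrightarrow> L) at_top \<and> L \<le> f x"
proof -
  define \<phi> where "\<phi> t = f (x + t *\<^sub>R v) - t * f v" for t
  have decreasing: "\<phi> t \<le> \<phi> s" if "s < t" for s t
  proof -
    have "f (x + t *\<^sub>R v) = f ((x + s *\<^sub>R v) + (t - s) *\<^sub>R v)" by (simp add: algebra_simps)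
    also have "\<dots> \<le> f (x + s *\<^sub>R v) + f ((t - s) *\<^sub>R v)"
      by (rule subadditive_along_convex_direction[OF hom convex_directions_scaleR[OF v]])
        (use span in simp)
    also have "f ((t - s) *\<^sub>R v) = (t - s) * f v"
      using that by (intro positively_1_homogeneousD[OF hom]) simp
    finally show ?thesis by (simp add: \<phi>_def algebra_simps)
  qed
  obtain C where C: "\<And>p. f p \<le> f (p + x) + C"
    using uniform_lower_bound_of_translate[OF hom span, of x] by blast
  have lower: "- C \<le> \<phi> t" if "t > 0" for t
  proof -
    have "t * f v = f (t *\<^sub>R v)" using positively_1_homogeneousD[OF hom that] by simp
    also have "\<dots> \<le> f (x + t *\<^sub>R v) + C" using C[of "t *\<^sub>R v"] by (simp add: add.commute)
    finally show ?thesis by (simp add: \<phi>_def)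
  qed
  have bdd: "bdd_below (\<phi> ` {0<..})" using lower by (auto intro!: bdd_belowI2)
  define L where "L = Inf (\<phi> ` {0<..})"
  have below: "L \<le> \<phi> t" if "t > 0" for t
    unfolding L_def by (rule cINF_lower[OF bdd]) (use that in simp)
  have "(\<phi> \<longlongrightarrow> L) at_top"
  proof (rule decreasing_tendsto)
    show "eventually (\<lambda>t. L \<le> \<phi> t) at_top"
      using eventually_gt_at_top[of 0] by eventually_elim (rule below)
    fix y assume "L < y"
    then obtain s where "s > 0" "\<phi> s < y"
      using cINF_less_iff[OF _ bdd, of y] unfolding L_def by auto
    then show "eventually (\<lambda>t. \<phi> t < y) at_top"
      by (intro eventually_mono[OF eventually_gt_at_top[of s]]) (use decreasing le_less_trans in blast)
  qed
  moreover have "L \<le> \<phi> 0" using below[of 1] decreasing[of 0 1] by simp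
  ultimately show ?thesis unfolding \<phi>_def by auto
qed

text \<open>
  The minorant is the limit of \<open>f (x + t v) - t f v\<close> for \<open>t \<rightarrow> \<infinity>\<close>.  Each property of \<open>f\<close> is
  passed to the limit; homogeneity and affinity along \<open>v\<close> come from the substitutions
  \<open>t \<mapsto> t / c\<close> and \<open>t \<mapsto> t + a\<close>.
\<close>
lemma affine_minorant_along_convex_direction:
  assumes hom: "positively_1_homogeneous f"
    and span: "span (convex_directions f) = UNIV"
    and v: "v \<in> convex_directions f"
  obtains g where "positively_1_homogeneous g" "\<And>x. g x \<le> f x"
    "convex_directions f \<subseteq> convex_directions g"
    "insert v (affine_directions f) \<subseteq> affine_directions g"
    "\<And>u. u \<in> insert v (affine_directions f) \<Longrightarrow> g u = f u"
proof -
  obtain g where lim: "\<And>x. ((\<lambda>t. f (x + t *\<^sub>R v) - t * f v) \<longlongrightarrow> g x) at_top"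
    and le: "\<And>x. g x \<le> f x"
    using recession_limit_exists[OF assms] by metis
  have g_eqI: "g x = y" if "((\<lambda>t. f (x + t *\<^sub>R v) - t * f v) \<longlongrightarrow> y) at_top" for x y
    using tendsto_unique[OF _ lim that] by simp
  have hom_g: "positively_1_homogeneous g"
    unfolding positively_1_homogeneous_def
  proof (intro allI impI)
    fix c :: real and x
    assume c: "c > 0"
    have "filterlim (\<lambda>t. (1/c) * t) at_top at_top"
      using c by (intro filterlim_tendsto_pos_mult_at_top[OF tendsto_const] filterlim_ident) auto
    from tendsto_mult_left[OF filterlim_compose[OF lim this], of c]
    have "((\<lambda>t. c * (f (x + (1/c * t) *\<^sub>R v) - 1/c * t * f v)) \<longlongrightarrow> c * g x) at_top" .
    moreover have "c * (f (x + (1/c * t) *\<^sub>R v) - 1/c * t * f v) = f (c *\<^sub>R x + t *\<^sub>R v) - t * f v" for t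
    proof -
      have "c *\<^sub>R (x + (1/c * t) *\<^sub>R v) = c *\<^sub>R x + t *\<^sub>R v"
        using c by (simp add: scaleR_add_right)
      then show ?thesis
        using positively_1_homogeneousD[OF hom c, of "x + (1/c * t) *\<^sub>R v"] c
        by (simp add: right_diff_distrib)
    qed
    ultimately show "g (c *\<^sub>R x) = c * g x" by (intro g_eqI) simp
  qed
  have g0: "g 0 = 0" by (rule positively_1_homogeneous_zero[OF hom_g])
  have shift_v: "g (x + a *\<^sub>R v) = g x + a * f v" for x a
  proof (rule g_eqI)
    have "filterlim (\<lambda>t. a + t) at_top at_top"
      by (intro filterlim_tendsto_add_at_top[OF tendsto_const] filterlim_ident)
    from tendsto_add[OF filterlim_compose[OF lim this] tendsto_const, of x "a * f v"]
    show "((\<lambda>t. f (x + a *\<^sub>R v + t *\<^sub>R v) - t * f v) \<longlongrightarrow> g x + a * f v) at_top"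
      by (simp add: algebra_simps)
  qed
  have shift_aff: "g (x + a *\<^sub>R u) = g x + a * f u" if u: "u \<in> affine_directions f" for x a u
  proof (rule g_eqI)
    have "f (x + a *\<^sub>R u + t *\<^sub>R v) = f (x + t *\<^sub>R v) + a * f u" for t
      using affine_directionsD[OF u, of "x + t *\<^sub>R v" a] by (simp add: algebra_simps)
    then show "((\<lambda>t. f (x + a *\<^sub>R u + t *\<^sub>R v) - t * f v) \<longlongrightarrow> g x + a * f u) at_top"
      using tendsto_add[OF lim tendsto_const, of x "a * f u"] by (simp add: algebra_simps)
  qed
  have shift: "g (x + a *\<^sub>R u) = g x + a * f u" if "u \<in> insert v (affine_directions f)" for x a u
    using that shift_v shift_aff by blast
  have eq: "g u = f u" if "u \<in> insert v (affine_directions f)" for u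
    using shift[OF that, of 0 1] g0 by simp
  have aff: "insert v (affine_directions f) \<subseteq> affine_directions g"
    using shift eq unfolding affine_directions_def by fastforce
  have conv: "convex_directions f \<subseteq> convex_directions g"
  proof
    fix u assume u: "u \<in> convex_directions f"
    show "u \<in> convex_directions g"
    proof (rule convex_directionsI)
      fix x and s a b :: real
      assume s: "0 < s" "s < 1"
      let ?\<phi> = "\<lambda>x t. f (x + t *\<^sub>R v) - t * f v"
      let ?z = "x + ((1 - s) * a + s * b) *\<^sub>R u"
      have le_t: "?\<phi> ?z t \<le> (1 - s) * ?\<phi> (x + a *\<^sub>R u) t + s * ?\<phi> (x + b *\<^sub>R u) t" for t
        using convex_directionsD[OF u, of s "x + t *\<^sub>R v" a b] s by (simp add: algebra_simps)
      have rhs: "((\<lambda>t. (1 - s) * ?\<phi> (x + a *\<^sub>R u) t + s * ?\<phi> (x + b *\<^sub>R u) t)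
          \<longlongrightarrow> (1 - s) * g (x + a *\<^sub>R u) + s * g (x + b *\<^sub>R u)) at_top"
        by (intro tendsto_add tendsto_mult_left lim)
      show "g ?z \<le> (1 - s) * g (x + a *\<^sub>R u) + s * g (x + b *\<^sub>R u)"
        by (rule tendsto_le[OF _ rhs lim]) (use le_t in auto)
    qed
  qed
  show ?thesis by (rule that[OF hom_g le conv aff eq])
qed

lemma affine_minorant_along_convex_directions:
  assumes "finite B" "positively_1_homogeneous f"
    and "span (convex_directions f) = UNIV" "B \<subseteq> convex_directions f"
  shows "\<exists>g. positively_1_homogeneous g \<and> (\<forall>x. g x \<le> f x) \<and>
    affine_directions f \<union> B \<subseteq> affine_directions g \<and> (\<forall>u\<in>affine_directions f. g u = f u)"
  using assms
proof (induction B arbitrary: f rule: finite_induct)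
  case empty
  then show ?case by blast
next
  case (insert v B)
  obtain h where h: "positively_1_homogeneous h" "\<And>x. h x \<le> f x"
    "convex_directions f \<subseteq> convex_directions h"
    "insert v (affine_directions f) \<subseteq> affine_directions h"
    "\<And>u. u \<in> insert v (affine_directions f) \<Longrightarrow> h u = f u"
    using affine_minorant_along_convex_direction[of f v] insert.prems by blast
  have "span (convex_directions h) = UNIV"
    using span_mono[OF h(3)] insert.prems(2) by blast
  then obtain g where g: "positively_1_homogeneous g" "\<forall>x. g x \<le> h x"
    "affine_directions h \<union> B \<subseteq> affine_directions g" "\<forall>u\<in>affine_directions h. g u = h u"
    using insert.IH[of h] h(1,3) insert.prems(3) by blast
  have "\<forall>x. g x \<le> f x" using g(2) h(2) order_trans by blast
  moreover have "\<forall>u\<in>affine_directions f. g u = f u" using g(4) h(4,5) by auto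
  ultimately show ?case using g(1,3) h(4) by blast
qed

text \<open>
  The slope along a direction of affinity is the same at every base point, so the increments of
  \<open>f\<close> along several such directions add up independently of where they start.
\<close>
lemma linear_if_affine_directions_span:
  assumes f0: "f 0 = 0" and span: "span (affine_directions f) = UNIV"
  shows "linear f"
proof -
  have shift: "f (x + u) = f x + f u" if "u \<in> span (affine_directions f)" for x u
    using that
  proof (induction arbitrary: x rule: span_induct_alt)
    case base
    show ?case by (simp add: f0)
  next
    case (step c v y)
    have "f (x + (c *\<^sub>R v + y)) = f (x + c *\<^sub>R v) + f y"
      using step.IH[of "x + c *\<^sub>R v"] by (simp add: add.assoc)
    also have "\<dots> = f x + (f (c *\<^sub>R v) + f y)"
      using affine_directionsD[OF step.hyps, of x c] affine_directionsD[OF step.hyps, of 0 c] f0 by simp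
    also have "f (c *\<^sub>R v) + f y = f (c *\<^sub>R v + y)"
      using step.IH[of "c *\<^sub>R v"] by simp
    finally show ?case .
  qed
  have scale: "f (c *\<^sub>R u) = c * f u" if "u \<in> span (affine_directions f)" for c u
    using that
  proof (induction rule: span_induct_alt)
    case base
    show ?case by (simp add: f0)
  next
    case (step a v y)
    have sc: "f (r *\<^sub>R v) = r * f v" for r
      using affine_directionsD[OF step.hyps, of 0 r] f0 by simp
    have "f (c *\<^sub>R (a *\<^sub>R v + y)) = f ((c * a) *\<^sub>R v) + f (c *\<^sub>R y)"
      using shift span by (simp add: scaleR_add_right)
    then show ?case using step.IH shift span by (simp add: sc algebra_simps)
  qed
  show ?thesis using shift scale span by (intro linearI) auto
qed

text \<open>
  The direction \<open>x0\<close> is treated before the spanning set, because only then is its value \<open>f x0\<close>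
  preserved by all later steps.
\<close>
theorem linear_minorant_at_convex_direction:
  assumes hom: "positively_1_homogeneous f"
    and B: "finite B" "B \<subseteq> convex_directions f" "span B = UNIV"
    and x0: "x0 \<in> convex_directions f"
  shows "\<exists>l. linear l \<and> l x0 = f x0 \<and> (\<forall>x. f x \<ge> l x)"
proof -
  have span_f: "span (convex_directions f) = UNIV" using span_mono[OF B(2)] B(3) by blast
  obtain h where h: "positively_1_homogeneous h" "\<And>x. h x \<le> f x"
    "convex_directions f \<subseteq> convex_directions h"
    "insert x0 (affine_directions f) \<subseteq> affine_directions h"
    "\<And>u. u \<in> insert x0 (affine_directions f) \<Longrightarrow> h u = f u"
    using affine_minorant_along_convex_direction[OF hom span_f x0] by blast
  have span_h: "span (convex_directions h) = UNIV" using span_mono[OF h(3)] span_f by blast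
  obtain l where l: "positively_1_homogeneous l" "\<forall>x. l x \<le> h x"
    "affine_directions h \<union> B \<subseteq> affine_directions l" "\<forall>u\<in>affine_directions h. l u = h u"
    using affine_minorant_along_convex_directions[OF B(1) h(1) span_h] B(2) h(3) by blast
  have "span (affine_directions l) = UNIV"
    using span_mono[of B "affine_directions l"] l(3) B(3) by blast
  then have "linear l"
    using linear_if_affine_directions_span positively_1_homogeneous_zero[OF l(1)] by blast
  moreover have "l x0 = f x0" using l(4) h(4,5) by simp
  moreover have "\<forall>x. f x \<ge> l x" using l(2) h(2) order_trans by blast
  ultimately show ?thesis by blast
qed

section \<open>Matrices of rank one\<close>

lemma rank_scaleR_le:
  fixes A :: "real ^ 'n ^ 'm"
  shows "rank (c *\<^sub>R A) \<le> rank A"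
proof -
  have "c *\<^sub>R A = (c *\<^sub>R mat 1) ** A"
    by (simp add: scalar_matrix_assoc[symmetric])
  then show ?thesis by (metis rank_mul_le_right)
qed

lemma rank_Basis_le_1:
  fixes A :: "real ^ 'n ^ 'm"
  assumes "A \<in> Basis"
  shows "rank A \<le> 1"
proof -
  obtain i and b :: "real ^ 'n" where A: "A = axis i b"
    using assms by (auto simp: Basis_vec_def)
  have "rows A \<subseteq> span {b}"
    by (auto simp: A rows_def row_def axis_def span_zero span_base)
  then have "dim (rows A) \<le> card {b}" by (rule dim_le_card) simp
  then show ?thesis by (simp add: row_rank_def)
qed

lemma rank_le_1_imp_convex_direction:
  assumes f: "rank_one_convex f" and v: "rank v \<le> 1"
  shows "v \<in> convex_directions f"
proof (rule convex_directionsI)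
  fix x and s a b :: real
  assume s: "0 < s" "s < 1"
  let ?p = "x + a *\<^sub>R v" and ?q = "x + b *\<^sub>R v"
  have "?p - ?q = (a - b) *\<^sub>R v" by (simp add: algebra_simps)
  then have "rank (?p - ?q) \<le> 1" using rank_scaleR_le[of "a - b" v] v by simp
  then have "convex_on (closed_segment ?p ?q) f"
    using f unfolding rank_one_convex_def by blast
  from convex_onD[OF this, of s ?p ?q] s
  show "f (x + ((1 - s) * a + s * b) *\<^sub>R v) \<le> (1 - s) * f ?p + s * f ?q"
    by (simp add: algebra_simps)
qed

theorem corollary1p2:
  fixes f :: "real ^ 'n ^ 'm \<Rightarrow> real"
  assumes "rank_one_convex f"
    and "positively_1_homogeneous f"
  shows "\<forall>x0. rank x0 \<le> 1 \<longrightarrow>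
           (\<exists>l. linear l \<and> l x0 = f x0 \<and> (\<forall>x. f x \<ge> l x))"
proof (intro allI impI)
  fix x0 :: "real ^ 'n ^ 'm"
  assume "rank x0 \<le> 1"
  then have "x0 \<in> convex_directions f"
    using rank_le_1_imp_convex_direction[OF assms(1)] by blast
  moreover have "Basis \<subseteq> convex_directions f"
    using rank_le_1_imp_convex_direction[OF assms(1) rank_Basis_le_1] by blast
  ultimately show "\<exists>l. linear l \<and> l x0 = f x0 \<and> (\<forall>x. f x \<ge> l x)"
    using linear_minorant_at_convex_direction[OF assms(2) finite_Basis] span_Basis by blast
qed

end
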